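(* Let $\mathcal{C}\subseteq\mathbb{R}^d$ be a compact convex set of diameter $\delta>0$, let $f\colon\mathcal{C}\to\mathbb{R}$ be a convex and $L$-smooth function satisfying a $(\mu,\theta)$-Hölderian error bound for some $\mu>0$ and $\theta\in\,]0,1/2]$ with unique minimizer $x^*\in\operatorname{argmin}_{x\in\mathcal{C}}f(x)$, and suppose that there exists $\beta>0$ such that $\operatorname{aff}(\mathcal{C})\cap B_\beta(x^* )\subseteq\mathcal{C}$. Let $S=\lceil 8L\delta^2(2\mu/\beta)^{1/\theta}\rceil$, $T\in\mathbb{N}$, and $\eta_t=\frac{4}{t+4}$ for all $t\in\mathbb{Z}$. Then, for the iterates $x_t$ of the Frank-Wolfe algorithm with step-size $\eta_t$, with $h_t=f(x_t)-f(x^* )$, it holds that $$h_t\le\max\left\{\left(\frac{\eta_{t-2}}{\eta_{S-1}}\right)^{1/(1-\theta)}h_S,\ \left(\frac{\eta_{t-2}\,2\mu L\delta^3}{\beta^2}\right)^{1/(1-\theta)}+\eta_{t-2}^2\frac{L\delta^2}{2}\right\}$$ for all $t\in\{S,\ldots,T\}$.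
   Context: Frank-Wolfe algorithm (FW): given $x_0\in\mathcal{C}$ and step-sizes $\eta_t\in[0,1]$ for $t\in\{0,\ldots,T-1\}$, for $t=0,\ldots,T-1$ choose $p_t\in\operatorname{argmin}_{p\in\mathcal{C}}\langle\nabla f(x_t),p-x_t\rangle$ and set $x_{t+1}=(1-\eta_t)x_t+\eta_tp_t$. $L$-smooth ($L>0$): $f$ is differentiable in an open set containing $\mathcal{C}$ and $f(y)\le f(x)+\langle\nabla f(x),y-x\rangle+\frac{L}{2}\|x-y\|_2^2$ for all $x,y\in\mathcal{C}$. $(\mu,\theta)$-Hölderian error bound (with unique minimizer $x^*$ of $f$ over $\mathcal{C}$): $\mu(f(x)-f(x^* ))^\theta\ge\|x-x^*\|_2$ for all $x\in\mathcal{C}$. $\operatorname{aff}(\mathcal{C})$ is the affine hull of $\mathcal{C}$, and $B_\beta(z)=\{x\in\mathbb{R}^d\mid\|x-z\|_2\le\beta\}$. The diameter is with respect to $\|\cdot\|_2$. *)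

theory Defs
  imports "HOL-Analysis.Analysis"
begin

text \<open>The value is unspecified wherever \<open>f\<close> is not differentiable.\<close>

definition gradient :: "('a::euclidean_space \<Rightarrow> real) \<Rightarrow> 'a \<Rightarrow> 'a" where
  "gradient f x = (THE g. GDERIV f x :> g)"

text \<open>
  Functions are total, so a function on \<open>C\<close> that is differentiable in an open set containing
  \<open>C\<close> is a function on the whole space whose values off that open set play no role.
\<close>

definition L_smooth_on :: "real \<Rightarrow> 'a::euclidean_space set \<Rightarrow> ('a \<Rightarrow> real) \<Rightarrow> bool" where
  "L_smooth_on L C f \<longleftrightarrow>
     L > 0 \<and>
     (\<exists>U. open U \<and> C \<subseteq> U \<and> f differentiable_on U) \<and>
     (\<forall>x\<in>C. \<forall>y\<in>C. f y \<le> f x + gradient f x \<bullet> (y - x) + L / 2 * (norm (x - y))\<^sup>2)"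

definition unique_minimizer_on :: "'a set \<Rightarrow> ('a \<Rightarrow> real) \<Rightarrow> 'a \<Rightarrow> bool" where
  "unique_minimizer_on C f z \<longleftrightarrow> {x. is_arg_min f (\<lambda>x. x \<in> C) x} = {z}"

text \<open>The convention \<open>0 powr \<theta> = 0\<close> agrees with the usual power, as \<open>\<theta> > 0\<close> in all uses.\<close>

definition holder_error_bound ::
    "real \<Rightarrow> real \<Rightarrow> 'a::euclidean_space set \<Rightarrow> ('a \<Rightarrow> real) \<Rightarrow> 'a \<Rightarrow> bool" where
  "holder_error_bound \<mu> \<theta> C f z \<longleftrightarrow>
     unique_minimizer_on C f z \<and>
     (\<forall>x\<in>C. \<mu> * (f x - f z) powr \<theta> \<ge> norm (x - z))"

text \<open>
  A run of \<open>T\<close> iterations: \<open>p\<close> is an arbitrary selection of minimizers of the linear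
  subproblems. Only \<open>x 0, \<dots>, x T\<close> and \<open>p 0, \<dots>, p (T - 1)\<close> are constrained.
\<close>

definition frank_wolfe_run ::
    "'a::euclidean_space set \<Rightarrow> ('a \<Rightarrow> real) \<Rightarrow> (nat \<Rightarrow> real) \<Rightarrow> nat \<Rightarrow> (nat \<Rightarrow> 'a) \<Rightarrow> (nat \<Rightarrow> 'a) \<Rightarrow> bool"
  where
  "frank_wolfe_run C f \<eta> T p x \<longleftrightarrow>
     x 0 \<in> C \<and>
     (\<forall>t<T. \<eta> t \<in> {0..1} \<and>
        is_arg_min (\<lambda>q. gradient f (x t) \<bullet> (q - x t)) (\<lambda>q. q \<in> C) (p t) \<and>
        x (Suc t) = (1 - \<eta> t) *\<^sub>R x t + \<eta> t *\<^sub>R p t)"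

text \<open>Division by zero makes the value at \<open>t = -4\<close> equal to \<open>0\<close>; only \<open>t \<ge> -1\<close> is ever used.\<close>

definition step_size :: "int \<Rightarrow> real" where
  "step_size t = 4 / (real_of_int t + 4)"

end

theory Submission
  imports Defs
begin

text \<open>
  For \<open>x \<in> C\<close> distinct from \<open>xstar\<close>, let \<open>q\<close> be the point at distance \<open>\<beta>\<close> beyond \<open>xstar\<close> on the
  ray from \<open>x\<close> through \<open>xstar\<close>.  It lies in \<open>C\<close>, so comparing the linear minimizer with \<open>q\<close> and using
  convexity and the error bound shows that the Frank--Wolfe gap is at least
  \<open>(\<beta> / \<mu>) (f x - f xstar)\<^bsup>1 - \<theta>\<^esup>\<close>.  It is also at least \<open>f x - f xstar\<close>.  Averaging both bounds,
  smoothness gives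
  \<open>h\<^sub>t\<^sub>+\<^sub>1 \<le> (1 - \<eta>\<^sub>t / 2) h\<^sub>t - \<eta>\<^sub>t (\<beta> / (2 \<mu>)) h\<^sub>t\<^bsup>1 - \<theta>\<^esup> + \<eta>\<^sub>t\<^sup>2 L \<delta>\<^sup>2 / 2\<close>.
  As \<open>1 - \<eta>\<^sub>t / 2 = \<eta>\<^sub>t / \<eta>\<^sub>t\<^sub>-\<^sub>2\<close>, this recursion telescopes against \<open>\<eta>\<^sub>t\<^sub>-\<^sub>2 \<eta>\<^sub>t\<^sub>-\<^sub>1\<close>.
\<close>

section \<open>First-order lower bound for convex functions\<close>

text \<open>Convexity bounds the difference quotients of \<open>f\<close> from \<open>x\<close>
  towards \<open>y\<close> by \<open>f y - f x\<close>; their right-hand limit at 0 is the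
  directional derivative.\<close>

lemma convex_on_gradient_le:
  fixes f :: "'a::euclidean_space \<Rightarrow> real"
  assumes cvx: "convex_on C f" and "x \<in> C" "y \<in> C" and diff: "f differentiable (at x)"
  shows "f x + gradient f x \<bullet> (y - x) \<le> f y"
proof -
  obtain g where g: "GDERIV f x :> g"
  proof -
    obtain D where D: "(f has_derivative D) (at x)"
      using diff by (auto simp: differentiable_def)
    then have lin: "linear D"
      by (simp add: has_derivative_linear)
    \<comment> \<open>The Riesz representer of the derivative, in coordinates.\<close>
    have "D = (\<lambda>v. v \<bullet> (\<Sum>b\<in>Basis. D b *\<^sub>R b))"
    proof
      fix v
      have "D v = D (\<Sum>b\<in>Basis. (v \<bullet> b) *\<^sub>R b)"
        by (simp add: euclidean_representation)
      also have "\<dots> = (\<Sum>b\<in>Basis. (v \<bullet> b) * D b)"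
        by (simp add: linear_sum[OF lin] linear_scale[OF lin])
      finally show "D v = v \<bullet> (\<Sum>b\<in>Basis. D b *\<^sub>R b)"
        by (simp add: inner_sum_right mult.commute)
    qed
    then show thesis
      using D that unfolding gderiv_def by metis
  qed
  \<comment> \<open>Uniqueness lets the definite description in \<open>gradient\<close> evaluate to
    \<open>g\<close>.\<close>
  have "g' = g" if "GDERIV f x :> g'" for g'
  proof -
    have "(\<lambda>v. v \<bullet> g') = (\<lambda>v. v \<bullet> g)"
      using that g unfolding gderiv_def by (rule has_derivative_unique)
    then show ?thesis
      by (metis vector_eq_ldot)
  qed
  with g have grad: "gradient f x = g"
    unfolding gradient_def by blast
  define \<phi> where "\<phi> = (\<lambda>s. f (x + s *\<^sub>R (y - x)))"
  have "(\<phi> has_real_derivative g \<bullet> (y - x)) (at 0)"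
  proof -
    have "((\<lambda>s::real. x + s *\<^sub>R (y - x)) has_derivative (\<lambda>s. s *\<^sub>R (y - x))) (at 0)"
      by (auto intro!: derivative_eq_intros)
    moreover have "(f has_derivative (\<lambda>v. v \<bullet> g)) (at (x + 0 *\<^sub>R (y - x)))"
      using g by (simp add: gderiv_def)
    ultimately have "(\<phi> has_derivative (\<lambda>s. (s *\<^sub>R (y - x)) \<bullet> g)) (at 0)"
      unfolding \<phi>_def by (rule has_derivative_compose)
    then show ?thesis
      by (simp add: has_field_derivative_def inner_commute mult.commute[of _ "g \<bullet> (y - x)"])
  qed
  then have "((\<lambda>s. (\<phi> s - \<phi> 0) / s) \<longlongrightarrow> g \<bullet> (y - x)) (at_right 0)"
    by (auto simp: has_field_derivative_iff intro: tendsto_mono[OF at_within_le_nhds]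
        filterlim_at_split[THEN iffD1, THEN conjunct2])
  moreover have "eventually (\<lambda>s. (\<phi> s - \<phi> 0) / s \<le> f y - f x) (at_right 0)"
  proof -
    have "eventually (\<lambda>s::real. s \<in> {0<..<1}) (at_right 0)"
      by (rule eventually_at_right_real) simp
    then show ?thesis
    proof eventually_elim
      case (elim s)
      have "\<phi> s = f ((1 - s) *\<^sub>R x + s *\<^sub>R y)"
        by (simp add: \<phi>_def algebra_simps)
      also have "\<dots> \<le> (1 - s) * f x + s * f y"
        using elim assms(2,3) by (intro convex_onD[OF cvx]) auto
      finally have "\<phi> s - \<phi> 0 \<le> s * (f y - f x)"
        by (simp add: \<phi>_def algebra_simps)
      then show ?case
        using elim by (simp add: divide_le_eq mult.commute)
    qed
  qed
  ultimately have "g \<bullet> (y - x) \<le> f y - f x"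
    by (intro tendsto_upperbound) auto
  then show ?thesis
    by (simp add: grad)
qed

section \<open>Scalar recursion with open-loop step sizes\<close>

text \<open>Rests on \<open>\<rho> \<le> \<rho> powr r\<close> for
  \<open>0 < \<rho> \<le> 1\<close>; it serves to move a contraction factor inside a power.\<close>

lemma powr_scaled_le:
  fixes \<rho> a r :: real
  assumes "0 \<le> \<rho>" "\<rho> \<le> 1" "0 \<le> a" "r \<le> 1"
  shows "\<rho> * a powr r \<le> (\<rho> * a) powr r"
proof (cases "\<rho> = 0")
  case False
  then have "\<rho> powr 1 \<le> \<rho> powr r"
    using assms by (intro powr_mono') auto
  with False show ?thesis
    using assms by (simp add: powr_mult mult_right_mono)
qed simp

text \<open>If \<open>h t\<close> is at most \<open>(\<eta> t * K) powr (1 / s)\<close>, adding the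
  error \<open>(\<eta> t)\<^sup>2 * B\<close> still meets the second bound. Otherwise
  \<open>B \<le> A * K\<close> makes the power term pay for that error, and \<open>h\<close>
  contracts by \<open>1 - \<eta> t / 2\<close>.\<close>

lemma open_loop_recursion_bound:
  fixes h :: "nat \<Rightarrow> real" and A B K s :: real
  assumes s: "1 / 2 \<le> s" and "0 \<le> A" "0 \<le> B" "0 \<le> K" "B \<le> A * K"
    and nonneg: "\<And>t. S \<le> t \<Longrightarrow> t \<le> T \<Longrightarrow> 0 \<le> h t"
    and step: "\<And>t. S \<le> t \<Longrightarrow> t < T \<Longrightarrow>
      h (Suc t) \<le> (1 - step_size (int t) / 2) * h t - step_size (int t) * (A * h t powr s)
        + (step_size (int t))\<^sup>2 * B"
    and "S \<le> t" "t \<le> T"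
  shows "h t \<le> max
    ((step_size (int t - 2) / step_size (int S - 1)) powr (1 / s) * h S)
    ((step_size (int t - 2) * K) powr (1 / s) + (step_size (int t - 2))\<^sup>2 * B)"
proof -
  define \<eta> where "\<eta> t = step_size (int t)" for t :: nat
  \<comment> \<open>Chosen so that \<open>a (Suc t) / a t\<close> is exactly the contraction factor.
    Integer arguments avoid truncated subtraction: \<open>a 0\<close> is the product of 2 and
    4/3.\<close>
  define a where "a t = step_size (int t - 2) * step_size (int t - 1)" for t :: nat
  \<comment> \<open>The exponent is halved because \<open>a t\<close> is comparable to a squared
    step size; \<open>s \<ge> 1 / 2\<close> gives the \<open>r \<le> 1\<close> required by
    \<open>powr_scaled_le\<close>.\<close>
  define r where "r = 1 / s / 2"
  have r: "0 < r" "r \<le> 1" and rs: "1 / s = 2 * r"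
    using s by (auto simp: r_def field_simps)
  have pos: "0 < a t" "0 < \<eta> t" for t
    by (auto simp: a_def \<eta>_def step_size_def)
  have \<rho>: "0 \<le> 1 - \<eta> t / 2" "1 - \<eta> t / 2 \<le> 1" for t
    by (auto simp: \<eta>_def step_size_def field_simps)
  have a_Suc: "a (Suc t) = (1 - \<eta> t / 2) * a t" for t
  proof -
    have "1 - \<eta> t / 2 = (real t + 2) / (real t + 4)"
      by (simp add: \<eta>_def step_size_def field_simps)
    then show ?thesis
      by (simp add: a_def step_size_def divide_simps) (simp add: algebra_simps)
  qed
  have \<eta>_a: "(\<eta> t)\<^sup>2 \<le> a (Suc t)" for t
    unfolding a_def \<eta>_def power2_eq_square
    by (intro mult_mono) (auto simp: step_size_def field_simps)
  have sq_powr: "(u\<^sup>2) powr r = u powr (1 / s)" if "0 \<le> u" for u :: real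
    using that by (simp add: rs powr_powr[symmetric])
  \<comment> \<open>Step sizes decrease, so the product lies between the squares of its factors.
    Enlarging \<open>a t\<close> and shrinking \<open>a S\<close> accounts for the indices
    \<open>t - 2\<close> and \<open>S - 1\<close> in the conclusion.\<close>
  have a_le: "a u \<le> (step_size (int u - 2))\<^sup>2" for u
    unfolding a_def power2_eq_square
    by (intro mult_mono) (auto simp: step_size_def field_simps)
  have S_le: "(step_size (int S - 1))\<^sup>2 \<le> a S"
    unfolding a_def power2_eq_square
    by (intro mult_mono) (auto simp: step_size_def field_simps)
  have "h t \<le> max ((a t / a S) powr r * h S) ((a t * K\<^sup>2) powr r + a t * B)"
    using \<open>S \<le> t\<close> \<open>t \<le> T\<close>
  proof (induction t rule: dec_induct)
    case base
    then show ?case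
      using pos[of S] by simp
  next
    case (step t)
    have h0: "0 \<le> h t" "0 \<le> h S"
      using step nonneg[of t] nonneg[of S] by auto
    have rec: "h (Suc t) \<le> (1 - \<eta> t / 2) * h t - \<eta> t * (A * h t powr s) + (\<eta> t)\<^sup>2 * B"
      using assms(7)[of t] step by (simp add: \<eta>_def)
    show ?case
    proof (cases "h t \<le> (\<eta> t * K) powr (1 / s)")
      case True
      \<comment> \<open>Below the threshold both gains are discarded: first the power term, then the
        contraction.\<close>
      have "h (Suc t) \<le> (1 - \<eta> t / 2) * h t + (\<eta> t)\<^sup>2 * B"
        using rec pos(2)[of t] \<open>0 \<le> A\<close>
        by (smt (verit) mult_nonneg_nonneg powr_ge_zero)
      also have "\<dots> \<le> h t + (\<eta> t)\<^sup>2 * B"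
        using \<rho>[of t] h0 by (simp add: mult_left_le_one_le)
      also have "h t \<le> ((\<eta> t)\<^sup>2 * K\<^sup>2) powr r"
        using True sq_powr[of "\<eta> t * K"] pos(2)[of t] \<open>0 \<le> K\<close> by (simp add: power_mult_distrib)
      also have "\<dots> \<le> (a (Suc t) * K\<^sup>2) powr r"
        using \<eta>_a[of t] r by (intro powr_mono2 mult_right_mono) auto
      also have "(\<eta> t)\<^sup>2 * B \<le> a (Suc t) * B"
        using \<eta>_a[of t] \<open>0 \<le> B\<close> by (intro mult_right_mono)
      finally show ?thesis
        by (simp add: max_def)
    next
      case False
      have "\<eta> t * K = ((\<eta> t * K) powr (1 / s)) powr s"
        using s pos(2)[of t] \<open>0 \<le> K\<close> by (simp add: powr_powr)
      also have "\<dots> \<le> h t powr s"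
        using False s by (intro powr_mono2) auto
      finally have "A * (\<eta> t * K) \<le> A * h t powr s"
        using \<open>0 \<le> A\<close> by (rule mult_left_mono)
      moreover have "\<eta> t * B \<le> A * (\<eta> t * K)"
        using \<open>B \<le> A * K\<close> pos(2)[of t] by (simp add: mult.left_commute mult_left_mono)
      ultimately have "\<eta> t * B \<le> A * h t powr s"
        by (rule order_trans[rotated])
      then have "\<eta> t * (\<eta> t * B) \<le> \<eta> t * (A * h t powr s)"
        using pos(2)[of t] by (intro mult_left_mono) auto
      with rec have "h (Suc t) \<le> (1 - \<eta> t / 2) * h t"
        by (simp add: power2_eq_square mult.assoc)
      also have "\<dots> \<le> (1 - \<eta> t / 2) * max ((a t / a S) powr r * h S) ((a t * K\<^sup>2) powr r + a t * B)"
        using step \<rho>[of t] by (intro mult_left_mono) auto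
      also have "\<dots> = max ((1 - \<eta> t / 2) * (a t / a S) powr r * h S)
          ((1 - \<eta> t / 2) * (a t * K\<^sup>2) powr r + (1 - \<eta> t / 2) * a t * B)"
        using \<rho>[of t] by (simp add: max_mult_distrib_left distrib_left mult.assoc)
      \<comment> \<open>\<open>powr_scaled_le\<close> absorbs the factor into both powers; the term
        linear in \<open>a t\<close> scales exactly.\<close>
      also have "\<dots> \<le> max ((a (Suc t) / a S) powr r * h S)
          ((a (Suc t) * K\<^sup>2) powr r + a (Suc t) * B)"
      proof (rule max.mono)
        show "(1 - \<eta> t / 2) * (a t / a S) powr r * h S \<le> (a (Suc t) / a S) powr r * h S"
          using powr_scaled_le[of "1 - \<eta> t / 2" "a t / a S" r] \<rho>[of t] pos[of t] pos[of S] r h0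
          by (intro mult_right_mono) (auto simp: a_Suc)
        show "(1 - \<eta> t / 2) * (a t * K\<^sup>2) powr r + (1 - \<eta> t / 2) * a t * B
            \<le> (a (Suc t) * K\<^sup>2) powr r + a (Suc t) * B"
          using powr_scaled_le[of "1 - \<eta> t / 2" "a t * K\<^sup>2" r] \<rho>[of t] pos[of t] r
          by (simp add: a_Suc mult.assoc)
      qed
      finally show ?thesis .
    qed
  qed
  also have "\<dots> \<le> max
    ((step_size (int t - 2) / step_size (int S - 1)) powr (1 / s) * h S)
    ((step_size (int t - 2) * K) powr (1 / s) + (step_size (int t - 2))\<^sup>2 * B)"
  proof (intro max.mono add_mono mult_right_mono)
    have nn: "0 \<le> step_size (int t - 2)" "0 < step_size (int S - 1)"
      by (auto simp: step_size_def)
    have "(a t / a S) powr r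
        \<le> ((step_size (int t - 2))\<^sup>2 / (step_size (int S - 1))\<^sup>2) powr r"
      using a_le[of t] S_le r pos nn
      by (intro powr_mono2 frac_le) (auto intro: less_imp_le)
    then show "(a t / a S) powr r
        \<le> (step_size (int t - 2) / step_size (int S - 1)) powr (1 / s)"
      using sq_powr[of "step_size (int t - 2) / step_size (int S - 1)"] nn
      by (simp add: power_divide)
    have "(a t * K\<^sup>2) powr r \<le> ((step_size (int t - 2))\<^sup>2 * K\<^sup>2) powr r"
      using a_le[of t] r pos(1)[of t] by (intro powr_mono2 mult_right_mono) auto
    then show "(a t * K\<^sup>2) powr r \<le> (step_size (int t - 2) * K) powr (1 / s)"
      using sq_powr[of "step_size (int t - 2) * K"] nn \<open>0 \<le> K\<close>
      by (simp add: power_mult_distrib)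
    show "a t \<le> (step_size (int t - 2))\<^sup>2"
      by (rule a_le)
  qed (use nonneg[of S] \<open>S \<le> t\<close> \<open>t \<le> T\<close> \<open>0 \<le> B\<close> in auto)
  finally show ?thesis .
qed

section \<open>Lower bound on the Frank-Wolfe gap\<close>

text \<open>The point is an affine combination of \<open>z\<close> and \<open>x\<close> with weights
  \<open>1 + c\<close> and \<open>- c\<close>, at distance exactly \<beta> from
  \<open>z\<close>.\<close>

lemma ray_beyond_mem:
  fixes C :: "'a::euclidean_space set"
  assumes "x \<in> C" "z \<in> C" "x \<noteq> z" "0 \<le> \<beta>" and sub: "affine hull C \<inter> cball z \<beta> \<subseteq> C"
  shows "z + (\<beta> / norm (z - x)) *\<^sub>R (z - x) \<in> C"
proof -
  let ?c = "\<beta> / norm (z - x)"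
  have "(1 + ?c) *\<^sub>R z + (- ?c) *\<^sub>R x \<in> affine hull C"
    using assms by (intro mem_affine[OF affine_affine_hull]) (auto intro: hull_inc)
  moreover have "(1 + ?c) *\<^sub>R z + (- ?c) *\<^sub>R x = z + ?c *\<^sub>R (z - x)"
    by (simp add: algebra_simps)
  moreover have "z + ?c *\<^sub>R (z - x) \<in> cball z \<beta>"
    using assms by (simp add: dist_norm)
  ultimately show ?thesis
    using sub by auto
qed

text \<open>Here \<open>d\<close> stands for \<open>f x - f z\<close>. Testing minimality at the
  point beyond \<open>z\<close> multiplies \<open>g \<bullet> (x - z)\<close> by
  \<open>1 + \<beta> / norm (x - z)\<close>, and the error bound controls that denominator.\<close>

lemma linear_minimizer_gap_ge_powr:
  fixes C :: "'a::euclidean_space set"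
  assumes "x \<in> C" "z \<in> C" "0 < \<beta>" "0 < \<mu>" and sub: "affine hull C \<inter> cball z \<beta> \<subseteq> C"
    and "0 \<le> d" "d \<le> g \<bullet> (x - z)" "norm (x - z) \<le> \<mu> * d powr \<theta>"
    and min: "\<And>q. q \<in> C \<Longrightarrow> g \<bullet> (p - x) \<le> g \<bullet> (q - x)"
  shows "\<beta> / \<mu> * d powr (1 - \<theta>) \<le> g \<bullet> (x - p)"
\<comment> \<open>For \<open>d = 0\<close> the left side is 0 and testing with \<open>q = x\<close>
  suffices; for \<open>d > 0\<close> the bound \<open>d \<le> g \<bullet> (x - z)\<close> forces
  \<open>x \<noteq> z\<close>.\<close>
proof (cases "d = 0")
  case True
  then show ?thesis
    using min[OF \<open>x \<in> C\<close>] by (simp add: inner_diff_right)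
next
  case False
  with assms have d: "0 < d" and ne: "x \<noteq> z"
    by auto
  define n where "n = norm (x - z)"
  have n: "0 < n" "n \<le> \<mu> * d powr \<theta>"
    using ne assms by (auto simp: n_def)
  have "z + (\<beta> / n) *\<^sub>R (z - x) \<in> C"
    using ray_beyond_mem[OF \<open>x \<in> C\<close> \<open>z \<in> C\<close> ne _ sub] assms by (simp add: n_def norm_minus_commute)
  from min[OF this] have gap: "(1 + \<beta> / n) * (g \<bullet> (x - z)) \<le> g \<bullet> (x - p)"
    by (simp add: inner_simps algebra_simps)
  have "\<beta> / \<mu> * d powr (1 - \<theta>) = \<beta> * d / (\<mu> * d powr \<theta>)"
    using d by (simp add: powr_diff)
  also have "\<dots> \<le> \<beta> * d / n"
    using n d \<open>0 < \<beta>\<close> by (intro frac_le) auto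
  also have "\<dots> \<le> (\<beta> / n) * (g \<bullet> (x - z))"
    using n assms by (simp add: divide_right_mono mult_left_mono)
  also have "\<dots> \<le> (1 + \<beta> / n) * (g \<bullet> (x - z))"
    using assms d by (intro mult_right_mono) auto
  finally show ?thesis
    using gap by simp
qed

section \<open>The recursion for the Frank-Wolfe iterates\<close>

theorem theorem3p6:
  fixes C :: "(real ^ 'd) set" and f :: "real ^ 'd \<Rightarrow> real" and xstar :: "real ^ 'd"
    and \<delta> L \<mu> \<theta> \<beta> :: real and S T :: nat
    and x p :: "nat \<Rightarrow> real ^ 'd" and h :: "nat \<Rightarrow> real"
  assumes "compact C" and "convex C"
    and "\<delta> = diameter C" and "\<delta> > 0"
    and "convex_on C f"
    and "L_smooth_on L C f"
    and "\<mu> > 0" and "0 < \<theta>" and "\<theta> \<le> 1 / 2"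
    and "unique_minimizer_on C f xstar"
    and "holder_error_bound \<mu> \<theta> C f xstar"
    and "\<beta> > 0" and "affine hull C \<inter> cball xstar \<beta> \<subseteq> C"
    and "S = nat \<lceil>8 * L * \<delta>\<^sup>2 * (2 * \<mu> / \<beta>) powr (1 / \<theta>)\<rceil>"
    and "frank_wolfe_run C f (\<lambda>t. step_size (int t)) T p x"
    and "\<And>t. h t = f (x t) - f xstar"
  shows "\<forall>t\<in>{S..T}.
    h t \<le> max
      ((step_size (int t - 2) / step_size (int S - 1)) powr (1 / (1 - \<theta>)) * h S)
      ((step_size (int t - 2) * (2 * \<mu> * L * \<delta> ^ 3 / \<beta>\<^sup>2)) powr (1 / (1 - \<theta>))
        + (step_size (int t - 2))\<^sup>2 * (L * \<delta>\<^sup>2 / 2))"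
proof
  fix t assume t: "t \<in> {S..T}"
  note cpt = assms(1) and cvx = assms(2) and \<delta>_def = assms(3) and h_def = assms(16)
  define A where "A = \<beta> / (2 * \<mu>)"
  define B where "B = L * \<delta>\<^sup>2 / 2"
  define K where "K = 2 * \<mu> * L * \<delta> ^ 3 / \<beta>\<^sup>2"
  obtain U where U: "open U" "C \<subseteq> U" "f differentiable_on U"
    and "L > 0"
    and smooth: "\<And>x y. x \<in> C \<Longrightarrow> y \<in> C \<Longrightarrow>
      f y \<le> f x + gradient f x \<bullet> (y - x) + L / 2 * (norm (x - y))\<^sup>2"
    using assms(6) unfolding L_smooth_on_def by blast
  have grad: "f x + gradient f x \<bullet> (y - x) \<le> f y" if "x \<in> C" "y \<in> C" for x y
    using convex_on_gradient_le[OF assms(5) that] U that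
    by (auto simp: differentiable_on_eq_differentiable_at)
  have dist: "norm (x - y) \<le> \<delta>" if "x \<in> C" "y \<in> C" for x y
    using diameter_bounded_bound[OF compact_imp_bounded[OF cpt] that] by (simp add: \<delta>_def dist_norm)
  have "is_arg_min f (\<lambda>x. x \<in> C) xstar"
    using assms(10) by (auto simp: unique_minimizer_on_def)
  then have z: "xstar \<in> C" and zmin: "\<And>x. x \<in> C \<Longrightarrow> f xstar \<le> f x"
    by (auto simp: is_arg_min_linorder)
  have holder: "norm (x - xstar) \<le> \<mu> * (f x - f xstar) powr \<theta>" if "x \<in> C" for x
    using assms(11) that by (simp add: holder_error_bound_def)
  \<comment> \<open>\<open>C\<close> contains \<open>xstar\<close> and a point at distance \<beta>
    from it; \<open>\<delta> > 0\<close> supplies a second point of \<open>C\<close> to start the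
    ray.\<close>
  have \<beta>_le: "\<beta> \<le> \<delta>"
  proof -
    obtain y where y: "y \<in> C" "y \<noteq> xstar"
    proof -
      have "C \<noteq> {xstar}"
        using \<open>\<delta> > 0\<close> by (auto simp: \<delta>_def)
      then show thesis
        using z that by blast
    qed
    show ?thesis
      using dist[OF ray_beyond_mem[OF y(1) z y(2) _ assms(13)] z] y \<open>\<beta> > 0\<close> by simp
  qed
  have eta: "step_size (int t) \<in> {0..1}"
    and lmo: "p t \<in> C" "\<And>q. q \<in> C \<Longrightarrow>
      gradient f (x t) \<bullet> (p t - x t) \<le> gradient f (x t) \<bullet> (q - x t)"
    and x_Suc: "x (Suc t) = (1 - step_size (int t)) *\<^sub>R x t + step_size (int t) *\<^sub>R p t"
    if "t < T" for t
    using assms(15) that by (auto simp: frank_wolfe_run_def is_arg_min_linorder)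
  \<comment> \<open>Restricted to \<open>t \<le> T\<close> because a run leaves later values of
    \<open>x\<close> unconstrained.\<close>
  have xC: "x t \<in> C" if "t \<le> T" for t
    using that
  proof (induction t)
    case 0
    then show ?case
      using assms(15) by (simp add: frank_wolfe_run_def)
  next
    case (Suc t)
    then show ?case
      using eta[of t] lmo(1)[of t] by (auto simp: x_Suc intro!: convexD[OF cvx])
  qed
  have rec: "h (Suc t) \<le> (1 - step_size (int t) / 2) * h t
      - step_size (int t) * (A * h t powr (1 - \<theta>)) + (step_size (int t))\<^sup>2 * B"
    if "t < T" for t
  proof -
    define e g where "e = step_size (int t)" and "g = gradient f (x t)"
    have e: "0 \<le> e"
      using eta[OF that] by (simp add: e_def)
    have x: "x t \<in> C" "x (Suc t) \<in> C" and p: "p t \<in> C"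
      using xC that lmo(1) by auto
    have lin: "h t \<le> g \<bullet> (x t - xstar)"
      using grad[OF x(1) z] by (simp add: h_def g_def inner_diff_right)
    have "\<beta> / \<mu> * h t powr (1 - \<theta>) \<le> g \<bullet> (x t - p t)"
      using lin zmin[OF x(1)] holder[OF x(1)] lmo(2)[OF that] assms(7,12,13)
      by (intro linear_minimizer_gap_ge_powr[OF x(1) z, where \<beta> = \<beta>]) (auto simp: h_def g_def)
    moreover have "h t \<le> g \<bullet> (x t - p t)"
      using lin lmo(2)[OF that z] by (simp add: g_def inner_diff_right)
    \<comment> \<open>The average of the two gap bounds; hence the 2 in the denominator of
      \<open>A\<close>.\<close>
    ultimately have "h t / 2 + A * h t powr (1 - \<theta>) \<le> g \<bullet> (x t - p t)"
      by (simp add: A_def)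
    then have gap: "e * (h t / 2 + A * h t powr (1 - \<theta>)) \<le> e * (g \<bullet> (x t - p t))"
      using e by (rule mult_left_mono)
    have diff: "x (Suc t) - x t = e *\<^sub>R (p t - x t)"
      using x_Suc[OF that] by (simp add: e_def algebra_simps)
    have "(norm (x t - x (Suc t)))\<^sup>2 = e\<^sup>2 * (norm (x t - p t))\<^sup>2"
      unfolding norm_minus_commute[of "x t"] diff by (simp add: power_mult_distrib)
    also have "\<dots> \<le> e\<^sup>2 * \<delta>\<^sup>2"
      using dist[OF x(1) p] by (intro mult_left_mono power_mono) auto
    finally have "L / 2 * (norm (x t - x (Suc t)))\<^sup>2 \<le> L / 2 * (e\<^sup>2 * \<delta>\<^sup>2)"
      using \<open>L > 0\<close> by (intro mult_left_mono) auto
    moreover have "g \<bullet> (x (Suc t) - x t) = - (e * (g \<bullet> (x t - p t)))"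
      by (simp add: diff inner_diff_right algebra_simps)
    ultimately have "h (Suc t) \<le> h t - e * (g \<bullet> (x t - p t)) + e\<^sup>2 * B"
      using smooth[OF x] by (simp add: h_def g_def B_def algebra_simps)
    with gap show ?thesis
      by (simp add: e_def algebra_simps)
  qed
  have "B \<le> A * K"
  proof -
    \<comment> \<open>The right side is \<open>A * K\<close>, and
      \<open>\<delta> / \<beta> \<ge> 1\<close> by \<open>\<beta>_le\<close>.\<close>
    have "B \<le> L * \<delta>\<^sup>2 * (\<delta> / \<beta>)"
      using \<beta>_le \<open>\<beta> > 0\<close> \<open>L > 0\<close> \<open>\<delta> > 0\<close> unfolding B_def
      by (simp add: field_simps)
    then show ?thesis
      using \<open>\<beta> > 0\<close> \<open>\<mu> > 0\<close> by (simp add: A_def K_def field_simps power2_eq_square power3_eq_cube)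
  qed
  \<comment> \<open>The recursion lemma applies with \<open>s = 1 - \<theta>\<close>;
    \<open>\<theta> \<le> 1 / 2\<close> yields \<open>s \<ge> 1 / 2\<close>.\<close>
  then have "h t \<le> max
      ((step_size (int t - 2) / step_size (int S - 1)) powr (1 / (1 - \<theta>)) * h S)
      ((step_size (int t - 2) * K) powr (1 / (1 - \<theta>)) + (step_size (int t - 2))\<^sup>2 * B)"
    using t assms(4,7,9,12) \<open>L > 0\<close> rec zmin[OF xC]
    by (intro open_loop_recursion_bound[where A = A and T = T])
      (auto simp: A_def B_def K_def h_def)
  then show "h t \<le> max
      ((step_size (int t - 2) / step_size (int S - 1)) powr (1 / (1 - \<theta>)) * h S)
      ((step_size (int t - 2) * (2 * \<mu> * L * \<delta> ^ 3 / \<beta>\<^sup>2)) powr (1 / (1 - \<theta>))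
        + (step_size (int t - 2))\<^sup>2 * (L * \<delta>\<^sup>2 / 2))"
    by (simp add: B_def K_def)
qed

end
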